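(* Let $M\ge1$. Suppose that a function $z$ of the variables $a_1,\dots,a_{M+1},b_1,\dots,b_{M+1}$ satisfies the system $q$-$RP^M_{\mathrm{degene}}$ (with parameter $\lambda$) given in the context. Put $$a_{M+1}=q,\quad b_{M+1}=C/A,\quad q^\lambda=A/q,\quad a_i=B_ix_i,\quad b_i=x_i\qquad(1\le i\le M).$$ Then $z$, as a function of $x_1,\dots,x_M$, is a solution of the $q$-Appell--Lauricella system $$[x_i(1-T_{x_j})(1-B_iT_{x_i})-x_j(1-T_{x_i})(1-B_jT_{x_j})]z=0\qquad(1\le i,j\le M),$$ $$[(1-T_{x_i})(1-Cq^{-1}T_{x_1}\cdots T_{x_M})-x_i(1-B_iT_{x_i})(1-AT_{x_1}\cdots T_{x_M})]z=0\qquad(1\le i\le M).$$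
   Context: Fix $q\in\mathbb C$ with $0<|q|<1$. $T_x$ is the $q$-shift $T_xf(x)=f(qx)$ in the variable $x$ (other variables fixed); under the substitution, $T_{x_i}=T_{a_i}T_{b_i}$ for $1\le i\le M$. $A,B_1,\dots,B_M,C$ are constants. It is always assumed that none of the denominators vanishes. $e_k$ is the elementary symmetric polynomial of degree $k$, and empty products equal $1$. The system $q$-$RP^M_{\mathrm{degene}}$ (obtained from the system satisfied by the integrals $\int_{q/a_i}^{q/a_j}\prod_{k=1}^{M+3}\frac{(a_kt)_\infty}{(b_kt)_\infty}d_qt$, $a_1\cdots a_{M+3}=q^2b_1\cdots b_{M+3}$, by setting $b_{M+3}=q^\lambda a_{M+3}$, $a_{M+3}\to\infty$, and then $b_{M+2}=q^\beta a_{M+2}$, $a_{M+2}\to0$) is: $$\hat E_M''z=0,$$ $$[(a_1-a_k)T_{a_l}^{-1}-(a_l-a_k)T_{a_1}^{-1}+(a_l-a_1)T_{a_k}^{-1}]z=0,$$ $$[(b_1-b_l)T_{b_k}-(b_k-b_l)T_{b_1}+(b_k-b_1)T_{b_l}]z=0,$$ $$[(b_1-q^{-1}a_k)T_{b_l}-(b_l-q^{-1}a_k)T_{b_1}+(b_l-b_1)T_{a_k}^{-1}]z=0,$$ $$[(qb_l-a_1)T_{a_k}^{-1}-(qb_l-a_k)T_{a_1}^{-1}+(a_1-a_k)T_{b_l}]z=0,$$ $$\left(q^{\lambda+1}\prod_{k=1}^{M+1}T_{a_k}T_{b_k}-1\right)z=0,$$ for $2\le k\neq l\le M+1$, where, with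 $T=T_{a_1}T_{b_1}$, $\hat a''=(a_2,\dots,a_{M+1})$, $\hat b''=(b_2,\dots,b_{M+1})$, $$\hat E_M''=\sum_{k=1}^{M+1}(-1)^kb_1^{M+1-k}\bigl[e_{k-1}(\hat a'')T^{-1}-q^{\lambda+1}e_{k-1}(\hat b'')\bigr]\prod_{n=0}^{M-k}\bigl(1-(a_1q^n/b_1)T\bigr)\prod_{n=0}^{k-2}(1-q^{-n}T).$$ *)

theory Defs
  imports "HOL-Analysis.Complex_Transcendental" "HOL-Library.Function_Algebras"
    "HOL-Library.FuncSet"
begin

text \<open>
  Linear operators on complex-valued functions on \<open>'v\<close>.  Sums and differences of operators are the
  pointwise ones of \<open>Function_Algebras\<close>, products of operators are compositions, and
  \<open>c \<odot> L\<close> is the operator \<open>L\<close> followed by multiplication by the function \<open>c\<close>.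
\<close>

type_synonym 'v oper = "('v \<Rightarrow> complex) \<Rightarrow> ('v \<Rightarrow> complex)"

definition scal :: "('v \<Rightarrow> complex) \<Rightarrow> 'v oper \<Rightarrow> 'v oper"  (infixr \<open>\<odot>\<close> 75) where
  "c \<odot> L = (\<lambda>F v. c v * L F v)"

definition oprod :: "(nat \<Rightarrow> 'v oper) \<Rightarrow> nat list \<Rightarrow> 'v oper" where
  "oprod L ks = foldr (\<lambda>k. (\<circ>) (L k)) ks id"

definition esym :: "nat \<Rightarrow> nat set \<Rightarrow> (nat \<Rightarrow> complex) \<Rightarrow> complex" where
  "esym k S f = (\<Sum>X | X \<subseteq> S \<and> card X = k. \<Prod>i\<in>X. f i)"

text \<open>
  A point \<open>(a, b)\<close> consists of the coordinates \<open>a i\<close>, \<open>b i\<close> with \<open>1 \<le> i \<le> M + 1\<close>.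
  \<open>Ta s i\<close> multiplies \<open>a i\<close> by \<open>s\<close>, so that \<open>Ta q i\<close> is the \<open>q\<close>-shift in \<open>a i\<close> and
  \<open>Ta (1 / q) i\<close> is its inverse; similarly for \<open>Tb\<close> and \<open>Tx\<close>.
\<close>

type_synonym point = "(nat \<Rightarrow> complex) \<times> (nat \<Rightarrow> complex)"

definition Ta :: "complex \<Rightarrow> nat \<Rightarrow> point oper" where
  "Ta s i F = (\<lambda>(a, b). F (a(i := s * a i), b))"

definition Tb :: "complex \<Rightarrow> nat \<Rightarrow> point oper" where
  "Tb s i F = (\<lambda>(a, b). F (a, b(i := s * b i)))"

definition Tx :: "complex \<Rightarrow> nat \<Rightarrow> (nat \<Rightarrow> complex) oper" where
  "Tx s i F = (\<lambda>x. F (x(i := s * x i)))"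

text \<open>
  The upper product bounds \<open>M - k\<close> and \<open>k - 2\<close>, which may be \<open>-1\<close>, are encoded by the index lists
  \<open>[0..<M + 1 - k]\<close> and \<open>[0..<k - 1]\<close>.
\<close>

definition E_op :: "complex \<Rightarrow> complex \<Rightarrow> nat \<Rightarrow> point oper" where
  "E_op q lam M =
    (let T = Ta q 1 \<circ> Tb q 1; T_inv = Ta (1 / q) 1 \<circ> Tb (1 / q) 1 in
     \<Sum>k = 1..M + 1.
       (\<lambda>(a, b). (- 1) ^ k * b 1 ^ (M + 1 - k)) \<odot>
       (((\<lambda>(a, b). esym (k - 1) {2..M + 1} a) \<odot> T_inv
          - (\<lambda>(a, b). q powr (lam + 1) * esym (k - 1) {2..M + 1} b) \<odot> id)
        \<circ> oprod (\<lambda>n. id - (\<lambda>(a, b). a 1 * q ^ n / b 1) \<odot> T) [0..<M + 1 - k]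
        \<circ> oprod (\<lambda>n. id - (\<lambda>(a, b). 1 / q ^ n) \<odot> T) [0..<k - 1]))"

text \<open>
  The operators act on functions defined on a set of points that is stable under all the
  \<open>q\<close>-shifts and their inverses and on which the denominator \<open>b 1\<close> does not vanish.
\<close>

definition shift_domain :: "complex \<Rightarrow> nat \<Rightarrow> point set \<Rightarrow> bool" where
  "shift_domain q M D \<longleftrightarrow>
     D \<subseteq> ({1..M + 1} \<rightarrow>\<^sub>E UNIV) \<times> ({1..M + 1} \<rightarrow>\<^sub>E UNIV) \<and>
     (\<forall>(a, b)\<in>D. b 1 \<noteq> 0 \<and>
        (\<forall>i\<in>{1..M + 1}. \<forall>s\<in>{q, 1 / q}.
           (a(i := s * a i), b) \<in> D \<and> (a, b(i := s * b i)) \<in> D))"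

definition annihilates_on :: "'v set \<Rightarrow> 'v oper \<Rightarrow> ('v \<Rightarrow> complex) \<Rightarrow> bool" where
  "annihilates_on D L F \<longleftrightarrow> (\<forall>v\<in>D. L F v = 0)"

definition RP_degene :: "complex \<Rightarrow> complex \<Rightarrow> nat \<Rightarrow> point set \<Rightarrow> (point \<Rightarrow> complex) \<Rightarrow> bool" where
  "RP_degene q lam M D z \<longleftrightarrow>
     annihilates_on D (E_op q lam M) z \<and>
     (\<forall>k\<in>{2..M + 1}. \<forall>l\<in>{2..M + 1}. k \<noteq> l \<longrightarrow>
        annihilates_on D
          ((\<lambda>(a, b). a 1 - a k) \<odot> Ta (1 / q) l - (\<lambda>(a, b). a l - a k) \<odot> Ta (1 / q) 1
            + (\<lambda>(a, b). a l - a 1) \<odot> Ta (1 / q) k) z \<and>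
        annihilates_on D
          ((\<lambda>(a, b). b 1 - b l) \<odot> Tb q k - (\<lambda>(a, b). b k - b l) \<odot> Tb q 1
            + (\<lambda>(a, b). b k - b 1) \<odot> Tb q l) z \<and>
        annihilates_on D
          ((\<lambda>(a, b). b 1 - a k / q) \<odot> Tb q l - (\<lambda>(a, b). b l - a k / q) \<odot> Tb q 1
            + (\<lambda>(a, b). b l - b 1) \<odot> Ta (1 / q) k) z \<and>
        annihilates_on D
          ((\<lambda>(a, b). q * b l - a 1) \<odot> Ta (1 / q) k - (\<lambda>(a, b). q * b l - a k) \<odot> Ta (1 / q) 1
            + (\<lambda>(a, b). a 1 - a k) \<odot> Tb q l) z) \<and>
     annihilates_on D
       ((\<lambda>_. q powr (lam + 1)) \<odot> oprod (\<lambda>k. Ta q k \<circ> Tb q k) [1..<M + 2] - id) z"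

definition appell_lauricella ::
  "complex \<Rightarrow> nat \<Rightarrow> complex \<Rightarrow> (nat \<Rightarrow> complex) \<Rightarrow> complex \<Rightarrow>
   (nat \<Rightarrow> complex) set \<Rightarrow> ((nat \<Rightarrow> complex) \<Rightarrow> complex) \<Rightarrow> bool" where
  "appell_lauricella q M A B C X F \<longleftrightarrow>
     (\<forall>i\<in>{1..M}. \<forall>j\<in>{1..M}.
        annihilates_on X
          ((\<lambda>x. x i) \<odot> ((id - Tx q j) \<circ> (id - (\<lambda>_. B i) \<odot> Tx q i))
            - (\<lambda>x. x j) \<odot> ((id - Tx q i) \<circ> (id - (\<lambda>_. B j) \<odot> Tx q j))) F) \<and>
     (\<forall>i\<in>{1..M}.
        annihilates_on X
          (((id - Tx q i) \<circ> (id - (\<lambda>_. C / q) \<odot> oprod (Tx q) [1..<M + 1]))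
            - (\<lambda>x. x i) \<odot> ((id - (\<lambda>_. B i) \<odot> Tx q i)
                \<circ> (id - (\<lambda>_. A) \<odot> oprod (Tx q) [1..<M + 1]))) F)"

definition subst_point ::
  "complex \<Rightarrow> nat \<Rightarrow> complex \<Rightarrow> (nat \<Rightarrow> complex) \<Rightarrow> complex \<Rightarrow> (nat \<Rightarrow> complex) \<Rightarrow> point" where
  "subst_point q M A B C x =
     (\<lambda>i\<in>{1..M + 1}. if i = M + 1 then q else B i * x i,
      \<lambda>i\<in>{1..M + 1}. if i = M + 1 then C / A else x i)"

end

theory Submission
  imports Defs
begin

text \<open>
  In the integral representation the shifts multiply the integrand by linear functions of the
  integration variable: \<open>1 - \<alpha> t\<close> for the inverse shift of \<open>a\<close>, with \<open>\<alpha> = a / q\<close>, and \<open>1 - b t\<close> for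
  the shift of \<open>b\<close>.  So \<open>a\<close> and \<open>b\<close> are treated on an equal footing: a point \<open>p\<close> assigns to each
  letter \<open>c\<close> the value \<open>p c\<close>, being \<open>\<alpha>\<close> or \<open>b\<close>, and \<open>up\<close> shifts a letter by its factor \<open>s c\<close>, being
  \<open>1 / q\<close> or \<open>q\<close>.  A relation \<open>tri\<close> states that three of the values \<open>f (up s c p)\<close> are values at
  \<open>p c\<close> of one affine function.

  The system gives this only for some triples of letters, and the missing ones cannot be obtained
  by elimination at points where parameters coincide.  There they follow from the relations at
  neighbouring points, by commuting two shifts (\<open>tri_transport\<close>).  A difference of two
  relations is then a four-term relation between \<open>z\<close>, \<open>T\<^sub>i z\<close>, \<open>T\<^sub>j z\<close> and \<open>T\<^sub>i T\<^sub>j z\<close>, where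
  \<open>T\<^sub>i\<close> shifts \<open>a i\<close> and \<open>b i\<close>.  For \<open>i, j \<le> M\<close> it is the first group of
  Appell--Lauricella equations; for \<open>j = M + 1\<close> the product relation turns it into the second
  group.  The operator \<open>E_op\<close> is needed only for \<open>M = 1\<close>, where there are no three-term relations
  and it is itself the four-term relation.
\<close>

section \<open>Collinear triples and three-term relations\<close>

text \<open>Up to sign this is the determinant with rows (1, 1, 1), (x, y, z), (X, Y, Z), so it
  vanishes iff (x, X), (y, Y), (z, Z) are collinear. For x = y different from z this forces X = Y,
  and for x = y = z it says nothing; hence the case distinctions below.\<close>

definition det3 :: "complex \<Rightarrow> complex \<Rightarrow> complex \<Rightarrow> complex \<Rightarrow> complex \<Rightarrow> complex \<Rightarrow> complex" where
  "det3 x y z X Y Z = (x - y) * Z + (y - z) * X + (z - x) * Y"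

lemma det3_line:
  assumes "x \<noteq> y" "det3 x y c X Y C = 0" "det3 x y d X Y D = 0" "det3 x y e X Y E = 0"
  shows "det3 c d e C D E = 0"
proof -
  have "(x - y) * det3 c d e C D E = 0"
    using assms(2-4) unfolding det3_def by algebra
  then show ?thesis using assms(1) by simp
qed

definition up :: "('l \<Rightarrow> complex) \<Rightarrow> 'l \<Rightarrow> ('l \<Rightarrow> complex) \<Rightarrow> 'l \<Rightarrow> complex" where
  "up s c p = p(c := s c * p c)"

definition dn :: "('l \<Rightarrow> complex) \<Rightarrow> 'l \<Rightarrow> ('l \<Rightarrow> complex) \<Rightarrow> 'l \<Rightarrow> complex" where
  "dn s c p = p(c := p c / s c)"

lemma up_apply [simp]: "up s c p d = (if d = c then s c * p c else p d)"
  by (simp add: up_def)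

lemma dn_apply [simp]: "dn s c p d = (if d = c then p c / s c else p d)"
  by (simp add: dn_def)

lemma up_dn: "s c \<noteq> 0 \<Longrightarrow> up s c (dn s c p) = p"
  by (auto simp: fun_eq_iff)

lemma up_commute: "up s c (up s d p) = up s d (up s c p)"
  by (auto simp: fun_eq_iff)

lemma up_zero: "p c = 0 \<Longrightarrow> up s c p = p"
  by (auto simp: fun_eq_iff)

definition tri ::
  "('l \<Rightarrow> complex) \<Rightarrow> (('l \<Rightarrow> complex) \<Rightarrow> complex) \<Rightarrow> 'l \<Rightarrow> 'l \<Rightarrow> 'l \<Rightarrow> ('l \<Rightarrow> complex) \<Rightarrow> complex" where
  "tri s f c d e p = det3 (p c) (p d) (p e) (f (up s c p)) (f (up s d p)) (f (up s e p))"

text \<open>Two distinct shifts among those of c, d, x, y lead to six values of \<open>f\<close>.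
  The relation for three letters after shifting the fourth involves three of them. Because shifts
  commute, the four relations of this kind have a signed sum that is identically zero; if two
  vanish, the other two agree.\<close>

lemma tri_transport:
  assumes "distinct [c, d, x, y]"
    and "tri s f d x y (up s c p) = 0" and "tri s f c x y (up s d p) = 0"
  shows "tri s f c d y (up s x p) = tri s f c d x (up s y p)"
proof -
  have comm: "up s c (up s x p) = up s x (up s c p)" "up s c (up s y p) = up s y (up s c p)"
    "up s d (up s x p) = up s x (up s d p)" "up s d (up s y p) = up s y (up s d p)"
    "up s d (up s c p) = up s c (up s d p)" "up s y (up s x p) = up s x (up s y p)"
    by (rule up_commute)+
  have ne: "c \<noteq> d" "d \<noteq> c" "c \<noteq> x" "x \<noteq> c" "c \<noteq> y" "y \<noteq> c" "d \<noteq> x" "x \<noteq> d" "d \<noteq> y" "y \<noteq> d"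
    "x \<noteq> y" "y \<noteq> x"
    using assms(1) by auto
  show ?thesis
    using assms(2,3) unfolding tri_def det3_def comm up_apply
    by (simp only: ne if_False comm) algebra
qed

lemma tri_perms:
  assumes "tri s f c d e p = 0"
  shows "tri s f c d e p = 0" "tri s f c e d p = 0" "tri s f d c e p = 0"
    "tri s f d e c p = 0" "tri s f e c d p = 0" "tri s f e d c p = 0"
  using assms by (simp_all add: tri_def det3_def algebra_simps eq_neg_iff_add_eq_0)

lemma tri_refl [simp]: "tri s f c c d p = 0" "tri s f c d c p = 0" "tri s f d c c p = 0"
  unfolding tri_def det3_def by algebra+

lemma tri_line:
  assumes "p x \<noteq> p y" "tri s f x y c p = 0" "tri s f x y d p = 0" "tri s f x y e p = 0"
  shows "tri s f c d e p = 0"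
  using det3_line assms unfolding tri_def by blast

lemma tri_eqD:
  assumes "tri s f c x y p = 0" "p x = p y" "p c \<noteq> p x"
  shows "f (up s x p) = f (up s y p)"
proof -
  have "(p c - p x) * (f (up s x p) - f (up s y p)) = 0"
    using assms(1,2) unfolding tri_def det3_def by algebra
  then show ?thesis using assms(3) by simp
qed

lemma tri_eqI:
  assumes "p x = p y" "f (up s x p) = f (up s y p)"
  shows "tri s f c x y p = 0"
  using assms by (simp add: tri_def det3_def algebra_simps)

lemma tri_cong:
  assumes "p x = p y" "f (up s x p) = f (up s y p)"
  shows "tri s f c d x p = tri s f c d y p"
  using assms by (simp add: tri_def det3_def algebra_simps)

section \<open>The missing three-term relations for three pairs of letters\<close>

text \<open>Each assumed triple takes one letter from every pair. Of the eight such triples, A1 B2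
  B3 and B1 A2 A3 are missing, and so are all triples containing a whole pair. The indices 2 and 3
  play symmetric roles.\<close>

locale three_pairs =
  fixes q :: complex and s :: "'l \<Rightarrow> complex" and P :: "('l \<Rightarrow> complex) set"
    and f :: "('l \<Rightarrow> complex) \<Rightarrow> complex" and A1 A2 A3 B1 B2 B3 :: 'l
  assumes q0: "q \<noteq> 0" and q1: "norm q < 1"
    and dist: "distinct [A1, A2, A3, B1, B2, B3]"
    and sA: "s A1 = 1 / q" "s A2 = 1 / q" "s A3 = 1 / q"
    and sB: "s B1 = q" "s B2 = q" "s B3 = q"
    and up_in: "\<And>p c. p \<in> P \<Longrightarrow> c \<in> {A1, A2, A3, B1, B2, B3} \<Longrightarrow> up s c p \<in> P"
    and dn_in: "\<And>p c. p \<in> P \<Longrightarrow> c \<in> {A1, A2, A3, B1, B2, B3} \<Longrightarrow> dn s c p \<in> P"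
    and B1_nz: "\<And>p. p \<in> P \<Longrightarrow> p B1 \<noteq> 0"
    and A1A2A3: "\<And>p. p \<in> P \<Longrightarrow> tri s f A1 A2 A3 p = 0"
    and B1B2B3: "\<And>p. p \<in> P \<Longrightarrow> tri s f B1 B2 B3 p = 0"
    and B1B2A3: "\<And>p. p \<in> P \<Longrightarrow> tri s f B1 B2 A3 p = 0"
    and B1B3A2: "\<And>p. p \<in> P \<Longrightarrow> tri s f B1 B3 A2 p = 0"
    and A1A3B2: "\<And>p. p \<in> P \<Longrightarrow> tri s f A1 A3 B2 p = 0"
    and A1A2B3: "\<And>p. p \<in> P \<Longrightarrow> tri s f A1 A2 B3 p = 0"
    and nz: "\<And>p. p \<in> P \<Longrightarrow> p A2 \<noteq> 0 \<or> p A3 \<noteq> 0 \<or> p B2 \<noteq> 0 \<or> p B3 \<noteq> 0"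
begin

abbreviation "F c p \<equiv> f (up s c p)"

lemma swap_2_3: "three_pairs q s P f A1 A3 A2 B1 B3 B2"
proof -
  have neg: "tri s f c d e p = - tri s f c e d p" for c d e p
    by (simp add: tri_def det3_def algebra_simps)
  show ?thesis
    using dist sA sB up_in dn_in B1_nz q0 q1 A1A2A3 B1B2B3 B1B2A3 B1B3A2 A1A3B2 A1A2B3 nz
    by unfold_locales (auto simp: neg[of A1 A3 A2] neg[of B1 B3 B2])
qed

lemma s_nz: "c \<in> {A1, A2, A3, B1, B2, B3} \<Longrightarrow> s c \<noteq> 0"
  using q0 sA sB by auto

lemma q_neq: "q \<noteq> 1" "q * q \<noteq> 1"
proof -
  show "q \<noteq> 1" using q1 by auto
  have "norm (q * q) < 1" using q1 by (simp add: norm_mult) (metis abs_norm_cancel abs_square_less_1 power2_eq_square)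
  then show "q * q \<noteq> 1" by auto
qed

lemma letters_neq:
  "A1 \<noteq> A2" "A1 \<noteq> A3" "A1 \<noteq> B1" "A1 \<noteq> B2" "A1 \<noteq> B3"
  "A2 \<noteq> A1" "A2 \<noteq> A3" "A2 \<noteq> B1" "A2 \<noteq> B2" "A2 \<noteq> B3"
  "A3 \<noteq> A1" "A3 \<noteq> A2" "A3 \<noteq> B1" "A3 \<noteq> B2" "A3 \<noteq> B3"
  "B1 \<noteq> A1" "B1 \<noteq> A2" "B1 \<noteq> A3" "B1 \<noteq> B2" "B1 \<noteq> B3"
  "B2 \<noteq> A1" "B2 \<noteq> A2" "B2 \<noteq> A3" "B2 \<noteq> B1" "B2 \<noteq> B3"
  "B3 \<noteq> A1" "B3 \<noteq> A2" "B3 \<noteq> A3" "B3 \<noteq> B1" "B3 \<noteq> B2"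
  using dist by auto

lemma scale_neq:
  assumes "x \<noteq> 0"
  shows "q * x \<noteq> x / q" "x \<noteq> x / q"
proof -
  show "q * x \<noteq> x / q"
  proof
    assume "q * x = x / q"
    then have "(q * q) * x = 1 * x" using q0 by (simp add: field_simps)
    then show False using assms q_neq by (metis mult_right_cancel)
  qed
  show "x \<noteq> x / q"
  proof
    assume "x = x / q"
    then have "q * x = 1 * x" using q0 by (simp add: field_simps)
    then show False using assms q_neq by (metis mult_right_cancel)
  qed
qed

text \<open>A1 and B1 are both collinear with B2 and A3, hence lie on their line if the values of B2
  and A3 differ. If these coincide, the two relations differ by (p A1 - p B1) * (F B2 p - F A3 p),
  which the two assumed relations make zero.\<close>

lemma tri_B2_eq_tri_A3:
  assumes p: "p \<in> P"
  shows "p B2 \<noteq> p A3 \<Longrightarrow> tri s f A1 B1 A3 p = 0"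
    and "tri s f A1 B1 B2 p = tri s f A1 B1 A3 p"
proof -
  note K = tri_perms[OF B1B2A3[OF p]] tri_perms[OF A1A3B2[OF p]]
  have *: "tri s f A1 B1 c p = 0" if "p B2 \<noteq> p A3" "c \<in> {A3, B2}" for c
    by (rule tri_line[of p B2 A3]) (use that in \<open>auto intro: K\<close>)
  then show "tri s f A1 B1 A3 p = 0" if "p B2 \<noteq> p A3" using that by simp
  show "tri s f A1 B1 B2 p = tri s f A1 B1 A3 p"
  proof (cases "p B2 = p A3")
    case True
    have "(p A1 - p B1) * (F B2 p - F A3 p) = 0"
      using A1A3B2[OF p] B1B2A3[OF p] True unfolding tri_def det3_def by algebra
    then show ?thesis using True unfolding tri_def det3_def by algebra
  qed (use * in simp)
qed

text \<open>The point on the right has the values of A3 and B2 multiplied by q and the others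
  unchanged, so that A3 can be separated from A2.\<close>

lemma tri_A3_shift:
  assumes "p \<in> P"
  shows "tri s f A1 B1 A3 p = tri s f A1 B1 A3 (up s B2 (dn s A3 p))"
proof -
  have "dn s A3 p \<in> P" using dn_in assms by simp
  then have "tri s f A1 B1 B2 (up s A3 (dn s A3 p)) = tri s f A1 B1 A3 (up s B2 (dn s A3 p))"
    using dist by (intro tri_transport) (auto intro: tri_perms(2)[OF B1B2A3] A1A3B2 up_in)
  then show ?thesis
    using tri_B2_eq_tri_A3(2)[OF assms] s_nz by (simp add: up_dn)
qed

lemma tri_B3_eq_tri_A2:
  assumes "p \<in> P"
  shows "p B3 \<noteq> p A2 \<Longrightarrow> tri s f A1 B1 A2 p = 0"
    and "tri s f A1 B1 B3 p = tri s f A1 B1 A2 p"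
proof -
  interpret sw: three_pairs q s P f A1 A3 A2 B1 B3 B2 by (rule swap_2_3)
  show "p B3 \<noteq> p A2 \<Longrightarrow> tri s f A1 B1 A2 p = 0"
    and "tri s f A1 B1 B3 p = tri s f A1 B1 A2 p"
    using sw.tri_B2_eq_tri_A3[OF assms] by auto
qed

text \<open>
  The relations at \<open>p\<close> alone do not imply this one, which is carried over from a point
  where \<open>B1\<close> and \<open>B3\<close> have different values.
\<close>

lemma tri_B2_exceptional:
  assumes p: "p \<in> P" and eq: "p B2 = p A3" and ne: "p A3 \<noteq> p A2"
    and e: "p A1 = p A2" "p B1 = p B3"
  shows "tri s f A1 B1 B2 p = 0"
proof -
  define p0 where "p0 = dn s B3 p"
  have p0: "p0 \<in> P" using dn_in p by (simp add: p0_def)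
  have up_o: "up s B3 p0 = p" using s_nz by (simp add: p0_def up_dn)
  \<comment> \<open>Here B1 and B3 have the values q * p B1 and p B1 / q, which differ since p B1 is
    nonzero and q * q is not 1.\<close>
  define r where "r = up s B1 p0"
  have r: "r \<in> P" using up_in p0 by (simp add: r_def)
  have B1nz: "p B1 \<noteq> 0" using B1_nz p .
  have r_val: "r A1 = p A2" "r A2 = p A2" "r A3 = p A3" "r B2 = p A3" "r B1 = q * p B1" "r B3 = p B1 / q"
    unfolding r_def p0_def by (simp_all add: letters_neq e eq sB)
  have r_ne: "r B1 \<noteq> r B3"
    using r_val(5,6) scale_neq(1)[OF B1nz] by simp
  have FA: "F A1 r = F A2 r"
    by (rule tri_eqD[of s f A3]) (use r_val(1-3) ne tri_perms(5)[OF A1A2A3[OF r]] in simp_all)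
  have B2B3A2: "tri s f B2 B3 A2 r = 0"
    by (rule tri_line[of r B1 B3]) (use r_ne tri_perms(2)[OF B1B2B3[OF r]] B1B3A2[OF r] in simp_all)
  \<comment> \<open>At \<open>r\<close> the letters A1 and A2 agree in value and in shifted value,
    so one may replace the other.\<close>
  have "tri s f B2 B3 A1 r = tri s f B2 B3 A2 r"
    using r_val(1,2) FA by (intro tri_cong) simp_all
  with B2B3A2 have "tri s f B2 B3 A1 r = 0" by simp
  then have 1: "tri s f A1 B3 B2 r = 0" by (rule tri_perms(6))
  \<comment> \<open>Transport exchanges the shifts of B3 and B2: the goal at \<open>p\<close>
    becomes the relation for A1, B1, B3 at \<open>t\<close>.\<close>
  define t where "t = up s B2 p0"
  have t: "t \<in> P" using up_in p0 by (simp add: t_def)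
  have t_val: "t A1 = p A2" "t A2 = p A2" "t A3 = p A3" "t B1 = p B1" "t B3 = p B1 / q"
    unfolding t_def p0_def by (simp_all add: letters_neq e eq sB)
  have t0: "tri s f A1 B1 B3 t = 0"
  proof (cases "t B3 = t A2")
    case False
    then show ?thesis using tri_B3_eq_tri_A2[OF t] by simp
  next
    case True
    have "F A1 t = F A2 t"
      by (rule tri_eqD[of s f A3]) (use t_val(1-3) ne tri_perms(5)[OF A1A2A3[OF t]] in simp_all)
    moreover have "F B3 t = F A2 t"
      by (rule tri_eqD[of s f B1])
        (use B1B3A2[OF t] t_val(4,5) True scale_neq(2)[OF B1nz] in simp_all)
    ultimately have "tri s f B1 A1 B3 t = 0"
      using t_val(1,2) True by (intro tri_eqI) simp_all
    then show ?thesis by (rule tri_perms(3))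
  qed
  have "tri s f A1 B1 B2 (up s B3 p0) = tri s f A1 B1 B3 (up s B2 p0)"
  proof (rule tri_transport)
    show "tri s f B1 B3 B2 (up s A1 p0) = 0"
      using up_in[OF p0, of A1] by (intro tri_perms(2)[OF B1B2B3]) simp
    show "tri s f A1 B3 B2 (up s B1 p0) = 0"
      using 1 unfolding r_def .
  qed (simp add: letters_neq)
  also have "\<dots> = 0" using t0 unfolding t_def .
  finally show ?thesis by (simp add: up_o)
qed

text \<open>Only equal values of B2 and A3 need work. Outside the exceptional case, A1 differs from
  A2 or B1 from B3. If A2 and B3 differ, their line contains A1 and B1, and the line through the
  differing pair brings A3 or B2 onto it. If A2 and B3 coincide, they become interchangeable, and so
  do A3 and B2 unless the claim is trivial.\<close>

lemma tri_A3_generic: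
  assumes p: "p \<in> P" and ne: "p A3 \<noteq> p A2"
  shows "tri s f A1 B1 A3 p = 0"
proof (cases "p B2 = p A3")
  case eq: True
  note K = tri_perms[OF A1A2A3[OF p]] tri_perms[OF B1B2B3[OF p]] tri_perms[OF B1B2A3[OF p]]
     tri_perms[OF A1A3B2[OF p]] tri_perms[OF A1A2B3[OF p]] tri_perms[OF B1B3A2[OF p]]
  show ?thesis
  proof (cases "p A1 = p A2 \<and> p B1 = p B3")
    case True
    then show ?thesis using tri_B2_exceptional[OF p eq ne] tri_B2_eq_tri_A3(2)[OF p] by simp
  next
    case False
    show ?thesis
    proof (cases "p B3 = p A2")
      case B3: False
      have on: "tri s f B3 A2 A1 p = 0" "tri s f B3 A2 B1 p = 0" by (rule K)+
      show ?thesis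
      proof (cases "p A1 = p A2")
        case A: False
        have "tri s f B3 A2 A3 p = 0"
          by (rule tri_line[of p A1 A2]) (use A in \<open>auto intro: K\<close>)
        with B3 on show ?thesis
          by (rule tri_line[of p B3 A2])
      next
        case True
        then have B: "p B1 \<noteq> p B3" using False by simp
        have "tri s f B3 A2 B2 p = 0"
          by (rule tri_line[of p B1 B3]) (use B in \<open>auto intro: K\<close>)
        with B3 on have "tri s f A1 B1 B2 p = 0"
          by (rule tri_line[of p B3 A2])
        then show ?thesis using tri_B2_eq_tri_A3(2)[OF p] by simp
      qed
    next
      case B3: True
      have FA: "F A2 p = F B3 p"
      proof (cases "p A1 = p A2")
        case True
        then have "p B1 \<noteq> p B3" using False by simp
        then show ?thesis using B3 by (intro tri_eqD[of s f B1]) (auto intro: K)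
      next
        case A: False
        then show ?thesis using B3 by (intro tri_eqD[of s f A1]) (auto intro: K)
      qed
      show ?thesis
      proof (cases "p A1 = p A3 \<and> p B1 = p A3")
        case True
        then show ?thesis by (simp add: tri_def det3_def)
      next
        case F: False
        have FB: "F A3 p = F B2 p"
        proof (cases "p A1 = p A3")
          case True
          then have "p B1 \<noteq> p A3" using F by simp
          then show ?thesis using eq by (intro tri_eqD[of s f B1]) (auto intro: K)
        next
          case A: False
          then show ?thesis using eq by (intro tri_eqD[of s f A1]) (auto intro: K)
        qed
        \<comment> \<open>\<open>K(7)\<close> is the relation for B1, B2, B3, in which A3 replaces
          B2 and A2 replaces B3.\<close>
        have "tri s f A2 A3 B1 p = 0"
          using K(7) FA FB eq B3 unfolding tri_def det3_def by algebra
        note on = this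
        show ?thesis
          by (rule tri_line[of p A2 A3]) (use ne in \<open>auto intro: K on\<close>)
      qed
    qed
  qed
qed (use tri_B2_eq_tri_A3(1)[OF p] in simp)

lemma tri_A1_B1_A3_B2:
  assumes p: "p \<in> P"
  shows "tri s f A1 B1 A3 p = 0" "tri s f A1 B1 B2 p = 0"
proof -
  show *: "tri s f A1 B1 A3 p = 0"
  proof (cases "p A3 = p A2 \<and> p B2 = p A3")
    case False
    then show ?thesis using tri_A3_generic[OF p] tri_B2_eq_tri_A3(1)[OF p] by metis
  next
    case True
    show ?thesis
    proof (cases "p A3 = 0")
      case False
      \<comment> \<open>Since p A2 = p A3 is nonzero and q is not 1, the value q * p A3 differs from
        p A2.\<close>
      let ?r = "up s B2 (dn s A3 p)"
      have "?r A3 = q * p A3" "?r A2 = p A2"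
        using dist sA by auto
      moreover have "?r \<in> P" using p up_in dn_in by simp
      ultimately show ?thesis
        using tri_A3_generic[of ?r] tri_A3_shift[OF p] True False q_neq by auto
    next
      case A3: True
      show ?thesis
      proof (cases "p A1 = 0")
        case True
        \<comment> \<open>A letter of value 0 is fixed by its shift, so A1 and A3 also agree in
          shifted value.\<close>
        then have "tri s f B1 A1 A3 p = 0"
          using A3 by (intro tri_eqI) (simp_all add: up_zero)
        then show ?thesis by (rule tri_perms)
      next
        case A1: False
        \<comment> \<open>As A2, A3 and B2 all have value 0, \<open>nz\<close> makes B3 the nonzero
          one.\<close>
        have B3: "p B3 \<noteq> p A2" using nz[OF p] True A3 by auto
        have A12: "p A1 \<noteq> p A2" using A1 A3 True by simp
        note K = tri_perms[OF A1A2A3[OF p]] tri_perms[OF A1A2B3[OF p]] tri_perms[OF B1B3A2[OF p]]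
        have on: "tri s f B3 A2 A3 p = 0"
          by (rule tri_line[of p A1 A2]) (use A12 in \<open>auto intro: K\<close>)
        show ?thesis
          by (rule tri_line[of p B3 A2]) (use B3 in \<open>auto intro: K on\<close>)
      qed
    qed
  qed
  then show "tri s f A1 B1 B2 p = 0" using tri_B2_eq_tri_A3(2)[OF p] by simp
qed

lemma tri_A1_B1:
  assumes p: "p \<in> P" and c: "c \<in> {A2, A3, B2, B3}"
  shows "tri s f A1 B1 c p = 0"
proof -
  interpret sw: three_pairs q s P f A1 A3 A2 B1 B3 B2 by (rule swap_2_3)
  show ?thesis using tri_A1_B1_A3_B2[OF p] sw.tri_A1_B1_A3_B2[OF p] c by auto
qed

text \<open>If A1 and B1 have different values, all the other letters lie on their line. Otherwise
  \<open>p\<close> arises by shifting B1 from a point where they differ, and transport carries the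
  relation over.\<close>

lemma tri_without_index1:
  assumes p: "p \<in> P" and cs: "c \<in> {A2, A3, B2, B3}" "d \<in> {A2, A3, B2, B3}" "e \<in> {A2, A3, B2, B3}"
    and dcs: "distinct [c, d, e]"
  shows "tri s f c d e p = 0"
proof -
  have *: "tri s f c d e r = 0" if "r \<in> P" "r A1 \<noteq> r B1"
    "c \<in> {A2, A3, B2, B3, B1}" "d \<in> {A2, A3, B2, B3, B1}" "e \<in> {A2, A3, B2, B3, B1}" for r c d e
    by (rule tri_line[of r A1 B1]) (use that in \<open>auto intro: tri_A1_B1\<close>)
  show ?thesis
  proof (cases "p A1 = p B1")
    case False
    then show ?thesis using * p cs by auto
  next
    case True
    define r where "r = dn s B1 p"
    have r: "r \<in> P" using dn_in p by (simp add: r_def)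
    have rp: "up s B1 r = p" using s_nz by (simp add: r_def up_dn)
    have "r A1 \<noteq> r B1"
      using True dist scale_neq(2)[OF B1_nz[OF p]] by (simp add: r_def sB)
    then have "(up s x r) A1 \<noteq> (up s x r) B1" "up s x r \<in> P" if "x \<in> {A2, A3, B2, B3}" for x
      using that dist up_in r by auto
    note ** = *[OF this(2,1)]
    have ne: "c \<noteq> B1" "d \<noteq> B1" "e \<noteq> B1" using cs dist by auto
    have "tri s f c d e (up s B1 r) = tri s f c d B1 (up s e r)"
      using dcs ne by (intro tri_transport **) (use cs in auto)
    also have "\<dots> = 0" by (rule **) (use cs in auto)
    finally show ?thesis by (simp add: rp)
  qed
qed

end

section \<open>From three-term to four-term relations\<close>

definition letter_shift :: "complex \<Rightarrow> nat + nat \<Rightarrow> complex" where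
  "letter_shift q = case_sum (\<lambda>_. 1 / q) (\<lambda>_. q)"

definition letter_point :: "complex \<Rightarrow> nat \<Rightarrow> (nat + nat \<Rightarrow> complex) \<Rightarrow> point" where
  "letter_point q M p = (\<lambda>i\<in>{1..M + 1}. q * p (Inl i), \<lambda>i\<in>{1..M + 1}. p (Inr i))"

definition shiftT :: "complex \<Rightarrow> nat \<Rightarrow> point \<Rightarrow> point" where
  "shiftT q i = (\<lambda>(a, b). (a(i := q * a i), b(i := q * b i)))"

definition four_term :: "complex \<Rightarrow> (point \<Rightarrow> complex) \<Rightarrow> nat \<Rightarrow> nat \<Rightarrow> point \<Rightarrow> complex" where
  "four_term q z i j = (\<lambda>(a, b). (b i - b j) * z (a, b) + (b j - a i) * z (shiftT q i (a, b))
     + (a j - b i) * z (shiftT q j (a, b)) + (a i - a j) * z (shiftT q i (shiftT q j (a, b))))"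

lemma shiftT_commute: "shiftT q i (shiftT q j v) = shiftT q j (shiftT q i v)"
  by (cases v) (auto simp: shiftT_def fun_eq_iff)

lemma four_term_commute: "four_term q z i j v = - four_term q z j i v"
  unfolding four_term_def shiftT_commute[of q i j] by (auto simp: algebra_simps split: prod.splits)

lemma letter_point_up:
  assumes "q \<noteq> 0" "i \<in> {1..M + 1}" "letter_point q M p = (a, b)"
  shows "letter_point q M (up (letter_shift q) (Inl i) p) = (a(i := 1 / q * a i), b)"
    and "letter_point q M (up (letter_shift q) (Inr i) p) = (a, b(i := q * b i))"
    and "letter_point q M (dn (letter_shift q) (Inl i) p) = (a(i := q * a i), b)"
    and "letter_point q M (dn (letter_shift q) (Inr i) p) = (a, b(i := 1 / q * b i))"
proof -
  have ab: "a = (\<lambda>i\<in>{1..M + 1}. q * p (Inl i))" "b = (\<lambda>i\<in>{1..M + 1}. p (Inr i))"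
    using assms(3) by (auto simp: letter_point_def)
  show "letter_point q M (up (letter_shift q) (Inl i) p) = (a(i := 1 / q * a i), b)"
    and "letter_point q M (up (letter_shift q) (Inr i) p) = (a, b(i := q * b i))"
    and "letter_point q M (dn (letter_shift q) (Inl i) p) = (a(i := q * a i), b)"
    and "letter_point q M (dn (letter_shift q) (Inr i) p) = (a, b(i := 1 / q * b i))"
    using assms(1,2) by (auto simp: ab letter_point_def letter_shift_def fun_eq_iff restrict_def)
qed

lemma letter_pointD:
  assumes "letter_point q M p = (a, b)" "i \<in> {1..M + 1}"
  shows "a i = q * p (Inl i)" "b i = p (Inr i)"
  using assms by (auto simp: letter_point_def)

lemma shift_domainD:
  assumes "shift_domain q M D" "(a, b) \<in> D"
  shows "b 1 \<noteq> 0" and "i \<in> {1..M + 1} \<Longrightarrow> (a(i := q * a i), b) \<in> D"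
    and "i \<in> {1..M + 1} \<Longrightarrow> (a(i := 1 / q * a i), b) \<in> D"
    and "i \<in> {1..M + 1} \<Longrightarrow> (a, b(i := q * b i)) \<in> D"
    and "i \<in> {1..M + 1} \<Longrightarrow> (a, b(i := 1 / q * b i)) \<in> D"
  using assms unfolding shift_domain_def by fastforce+

lemma shiftT_in:
  assumes "shift_domain q M D" "v \<in> D" "i \<in> {1..M + 1}"
  shows "shiftT q i v \<in> D"
proof -
  obtain a b where v: "v = (a, b)" by fastforce
  show ?thesis
    using shift_domainD(4)[OF assms(1) shift_domainD(2)[OF assms(1) _ assms(3)] assms(3)] assms(2)
    by (simp add: v shiftT_def)
qed

lemma point_letters:
  assumes "shift_domain q M D" "q \<noteq> 0" "(a, b) \<in> D"
  shows "letter_point q M (case_sum (\<lambda>i. a i / q) b) = (a, b)"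
proof -
  have "a \<in> {1..M + 1} \<rightarrow>\<^sub>E UNIV" "b \<in> {1..M + 1} \<rightarrow>\<^sub>E UNIV"
    using assms unfolding shift_domain_def by auto
  then show ?thesis
    using assms(2) by (auto simp: letter_point_def fun_eq_iff restrict_def PiE_def extensional_def)
qed

text \<open>Both relations contain the value at the point where \<open>a i\<close> and
  \<open>b j\<close> are multiplied by q, with the same coefficient, so it cancels in the
  difference. The four remaining values are those of the four-term relation. In \<open>p0\<close>
  the letters \<open>Inl i\<close> and \<open>Inl j\<close> carry \<open>a i\<close> and
  \<open>a j\<close> themselves, their values a / q having been multiplied by q.\<close>

lemma four_term_letters:
  assumes "q \<noteq> 0" "i \<noteq> j" "i \<in> {1..M + 1}" "j \<in> {1..M + 1}" "letter_point q M p = (a, b)"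
    and "p0 = dn (letter_shift q) (Inl i) (dn (letter_shift q) (Inl j) p)"
    and "tri (letter_shift q) (z \<circ> letter_point q M) (Inl i) (Inr i) (Inr j) (up (letter_shift q) (Inl j) p0)
       = tri (letter_shift q) (z \<circ> letter_point q M) (Inl i) (Inr i) (Inl j) (up (letter_shift q) (Inr j) p0)"
  shows "four_term q z i j (a, b) = 0"
proof -
  let ?s = "letter_shift q"
  let ?T = "\<lambda>i p. up ?s (Inr i) (dn ?s (Inl i) p)"
  have T: "letter_point q M (?T i p) = shiftT q i (a, b)" if "i \<in> {1..M + 1}" "letter_point q M p = (a, b)" for i p a b
    using letter_point_up(2)[OF assms(1) that(1) letter_point_up(3)[OF assms(1) that]] by (simp add: shiftT_def)
  have TT: "letter_point q M (?T i (?T j p)) = shiftT q i (shiftT q j (a, b))"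
    using T[OF assms(3), of "?T j p"] T[OF assms(4,5)] by (metis surj_pair)
  have u: "up ?s (Inl i) (up ?s (Inl j) p0) = p" "up ?s (Inr i) (up ?s (Inl j) p0) = ?T i p"
    "up ?s (Inr j) (up ?s (Inl j) p0) = up ?s (Inr j) (dn ?s (Inl i) p)"
    "up ?s (Inl i) (up ?s (Inr j) p0) = ?T j p" "up ?s (Inr i) (up ?s (Inr j) p0) = ?T i (?T j p)"
    "up ?s (Inl j) (up ?s (Inr j) p0) = up ?s (Inr j) (dn ?s (Inl i) p)"
    using assms(1,2) by (auto simp: fun_eq_iff assms(6) letter_shift_def)
  have val: "(up ?s (Inl j) p0) (Inl i) = a i" "(up ?s (Inl j) p0) (Inr i) = b i" "(up ?s (Inl j) p0) (Inr j) = b j"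
    "(up ?s (Inr j) p0) (Inl i) = a i" "(up ?s (Inr j) p0) (Inr i) = b i" "(up ?s (Inr j) p0) (Inl j) = a j"
    using assms(1,2) letter_pointD[OF assms(5,3)] letter_pointD[OF assms(5,4)]
    by (auto simp: assms(6) letter_shift_def)
  show ?thesis
    using assms(7) unfolding tri_def det3_def val u comp_def T[OF assms(3,5)] T[OF assms(4,5)] TT assms(5)
      four_term_def by (simp add: algebra_simps)
qed

lemma letters_three_pairs:
  assumes q: "q \<noteq> 0" "norm q < 1" and D: "shift_domain q M D" and z: "RP_degene q lam M D z"
    and jk: "j \<in> {2..M + 1}" "k \<in> {2..M + 1}" "j \<noteq> k"
  shows "three_pairs q (letter_shift q)
    {p. letter_point q M p \<in> D \<and> (p (Inl j) \<noteq> 0 \<or> p (Inl k) \<noteq> 0 \<or> p (Inr j) \<noteq> 0 \<or> p (Inr k) \<noteq> 0)}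
    (z \<circ> letter_point q M) (Inl 1) (Inl j) (Inl k) (Inr 1) (Inr j) (Inr k)"
proof -
  let ?s = "letter_shift q" and ?f = "z \<circ> letter_point q M"
  have ann: "annihilates_on D
          ((\<lambda>(a, b). a 1 - a k) \<odot> Ta (1 / q) l - (\<lambda>(a, b). a l - a k) \<odot> Ta (1 / q) 1
            + (\<lambda>(a, b). a l - a 1) \<odot> Ta (1 / q) k) z"
        "annihilates_on D
          ((\<lambda>(a, b). b 1 - b l) \<odot> Tb q k - (\<lambda>(a, b). b k - b l) \<odot> Tb q 1
            + (\<lambda>(a, b). b k - b 1) \<odot> Tb q l) z"
        "annihilates_on D
          ((\<lambda>(a, b). b 1 - a k / q) \<odot> Tb q l - (\<lambda>(a, b). b l - a k / q) \<odot> Tb q 1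
            + (\<lambda>(a, b). b l - b 1) \<odot> Ta (1 / q) k) z"
        "annihilates_on D
          ((\<lambda>(a, b). q * b l - a 1) \<odot> Ta (1 / q) k - (\<lambda>(a, b). q * b l - a k) \<odot> Ta (1 / q) 1
            + (\<lambda>(a, b). a 1 - a k) \<odot> Tb q l) z"
    if "k \<in> {2..M + 1}" "l \<in> {2..M + 1}" "k \<noteq> l" for k l
    using z that unfolding RP_degene_def by blast+
  have rel: "tri ?s ?f (Inl 1) (Inl k) (Inl l) p = 0" "tri ?s ?f (Inr 1) (Inr k) (Inr l) p = 0"
    "tri ?s ?f (Inr 1) (Inr l) (Inl k) p = 0" "tri ?s ?f (Inl 1) (Inl k) (Inr l) p = 0"
    if "k \<in> {2..M + 1}" "l \<in> {2..M + 1}" "k \<noteq> l" and p: "letter_point q M p \<in> D" for k l p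
  proof -
    obtain a b where ab: "letter_point q M p = (a, b)" by fastforce
    have v: "a 1 = q * p (Inl 1)" "a k = q * p (Inl k)" "a l = q * p (Inl l)"
      "b 1 = p (Inr 1)" "b k = p (Inr k)" "b l = p (Inr l)"
      using letter_pointD[OF ab] that by auto
    have i: "1 \<in> {1..M + 1}" "k \<in> {1..M + 1}" "l \<in> {1..M + 1}" using that by auto
    note up = letter_point_up(1,2)[OF q(1) i(1) ab] letter_point_up(1,2)[OF q(1) i(2) ab]
      letter_point_up(1,2)[OF q(1) i(3) ab]
    \<comment> \<open>The system has coefficients in a, which is q times the letter value.\<close>
    have "q * tri ?s ?f (Inl 1) (Inl k) (Inl l) p = 0"
      using bspec[OF ann(1)[OF that(1-3), unfolded annihilates_on_def] p] q(1) unfolding tri_def det3_def comp_def up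
      by (simp add: ab scal_def Ta_def Tb_def v plus_fun_def fun_diff_def algebra_simps del: One_nat_def)
    then show "tri ?s ?f (Inl 1) (Inl k) (Inl l) p = 0" using q(1) by simp
    show "tri ?s ?f (Inr 1) (Inr k) (Inr l) p = 0"
      using bspec[OF ann(2)[OF that(1-3), unfolded annihilates_on_def] p] unfolding tri_def det3_def comp_def up
      by (simp add: ab scal_def Ta_def Tb_def v plus_fun_def fun_diff_def algebra_simps del: One_nat_def)
    show "tri ?s ?f (Inr 1) (Inr l) (Inl k) p = 0"
      using bspec[OF ann(3)[OF that(1-3), unfolded annihilates_on_def] p] q(1) unfolding tri_def det3_def comp_def up
      by (simp add: ab scal_def Ta_def Tb_def v plus_fun_def fun_diff_def algebra_simps del: One_nat_def)
    have "q * tri ?s ?f (Inl 1) (Inl k) (Inr l) p = 0"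
      using bspec[OF ann(4)[OF that(1-3), unfolded annihilates_on_def] p] q(1) unfolding tri_def det3_def comp_def up
      by (simp add: ab scal_def Ta_def Tb_def v plus_fun_def fun_diff_def algebra_simps del: One_nat_def)
    then show "tri ?s ?f (Inl 1) (Inl k) (Inr l) p = 0" using q(1) by simp
  qed
  have closed: "letter_point q M (up ?s c p) \<in> D \<and> letter_point q M (dn ?s c p) \<in> D"
    if p: "letter_point q M p \<in> D" and c: "c \<in> {Inl 1, Inl j, Inl k, Inr 1, Inr j, Inr k}" for c p
  proof -
    obtain a b where ab: "letter_point q M p = (a, b)" by fastforce
    show ?thesis
      using c jk shift_domainD(2-5)[OF D p[unfolded ab]] letter_point_up[OF q(1) _ ab] by auto
  qed
  have b1: "p (Inr 1) \<noteq> 0" if "letter_point q M p \<in> D" for p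
  proof -
    obtain a b where ab: "letter_point q M p = (a, b)" by fastforce
    then have "b 1 = p (Inr 1)" by (rule letter_pointD) simp
    then show ?thesis using shift_domainD(1)[OF D that[unfolded ab]] by simp
  qed
  show ?thesis
    by unfold_locales
      (use jk q closed b1 rel[OF jk] rel(3,4)[OF jk(2,1) jk(3)[symmetric]] in
        \<open>auto simp: letter_shift_def split: if_splits\<close>)
qed

lemma four_term_triple:
  assumes q: "q \<noteq> 0" "norm q < 1" and D: "shift_domain q M D" and z: "RP_degene q lam M D z"
    and jk: "j \<in> {2..M + 1}" "k \<in> {2..M + 1}" "j \<noteq> k"
    and ab: "(a, b) \<in> D" and nonzero: "a j \<noteq> 0 \<or> a k \<noteq> 0 \<or> b j \<noteq> 0 \<or> b k \<noteq> 0"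
  shows "four_term q z 1 j (a, b) = 0" and "four_term q z j k (a, b) = 0"
proof -
  let ?s = "letter_shift q" and ?f = "z \<circ> letter_point q M"
  let ?P = "{p. letter_point q M p \<in> D \<and>
    (p (Inl j) \<noteq> 0 \<or> p (Inl k) \<noteq> 0 \<or> p (Inr j) \<noteq> 0 \<or> p (Inr k) \<noteq> 0)}"
  interpret three_pairs q ?s ?P ?f "Inl 1" "Inl j" "Inl k" "Inr 1" "Inr j" "Inr k"
    using letters_three_pairs[OF q D z jk] .
  define p :: "nat + nat \<Rightarrow> complex" where "p = case_sum (\<lambda>i. a i / q) b"
  have pt: "letter_point q M p = (a, b)" using point_letters[OF D q(1) ab] by (simp add: p_def)
  have p: "p \<in> ?P" using pt ab nonzero q by (auto simp: p_def)
  have i: "1 \<in> {1..M + 1}" "j \<in> {1..M + 1}" "k \<in> {1..M + 1}" "1 \<noteq> j" using jk by auto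
  have up2: "up ?s c (dn ?s d (dn ?s e p)) \<in> ?P"
    if "c \<in> {Inl 1, Inl j, Inl k, Inr 1, Inr j, Inr k}" "d \<in> {Inl 1, Inl j, Inl k, Inr 1, Inr j, Inr k}"
      "e \<in> {Inl 1, Inl j, Inl k, Inr 1, Inr j, Inr k}" for c d e
    using up_in[OF dn_in[OF dn_in[OF p that(3)] that(2)] that(1)] .
  show "four_term q z 1 j (a, b) = 0"
    using tri_A1_B1[OF up2, of "Inl j" "Inl 1" "Inl j" "Inr j"] tri_A1_B1[OF up2, of "Inr j" "Inl 1" "Inl j" "Inl j"]
    by (intro four_term_letters[OF q(1) i(4,1,2) pt refl]) simp
  show "four_term q z j k (a, b) = 0"
    using tri_without_index1[OF up2, of "Inl k" "Inl j" "Inl k" "Inl j" "Inr j" "Inr k"]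
      tri_without_index1[OF up2, of "Inr k" "Inl j" "Inl k" "Inl j" "Inr j" "Inl k"] jk
    by (intro four_term_letters[OF q(1) jk(3) i(2,3) pt refl]) simp
qed

text \<open>Index 1 and \<open>j\<close> are completed to a triple by M + 1, or by 2 if j = M + 1;
  then a (M + 1) is a nonzero parameter of the triple. For \<open>i\<close> and \<open>j\<close>
  both different from 1, either one of their four parameters is nonzero or every coefficient of the
  relation vanishes.\<close>

lemma four_term_many:
  assumes q: "q \<noteq> 0" "norm q < 1" and D: "shift_domain q M D" and z: "RP_degene q lam M D z"
    and M: "M \<ge> 2" and ij: "i \<in> {1..M}" "j \<in> {1..M + 1}" "i \<noteq> j"
    and ab: "(a, b) \<in> D" and nz: "a (M + 1) \<noteq> 0"
  shows "four_term q z i j (a, b) = 0"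
proof -
  have one: "four_term q z 1 j (a, b) = 0" if "j \<in> {2..M + 1}" for j
  proof (cases "j = M + 1")
    case True
    then show ?thesis using four_term_triple(1)[OF q D z that, of 2 a b] M nz ab by auto
  next
    case False
    then show ?thesis using four_term_triple(1)[OF q D z that, of "M + 1" a b] M nz ab by auto
  qed
  show ?thesis
  proof (cases "i = 1 \<or> j = 1")
    case True
    then show ?thesis using one[of i] one[of j] ij four_term_commute[of q z i j] by auto
  next
    case False
    then have ge2: "i \<in> {2..M + 1}" "j \<in> {2..M + 1}" using ij by auto
    show ?thesis
    proof (cases "a i \<noteq> 0 \<or> a j \<noteq> 0 \<or> b i \<noteq> 0 \<or> b j \<noteq> 0")
      case True
      then show ?thesis using four_term_triple(2)[OF q D z ge2 ij(3) ab] by auto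
    next
      case False
      then show ?thesis by (simp add: four_term_def)
    qed
  qed
qed


section \<open>The product relation and the case M = 1\<close>

lemma oprod_Cons: "oprod L (k # ks) = L k \<circ> oprod L ks"
  by (simp add: oprod_def)

lemma oprod_shift:
  assumes "distinct ks"
  shows "oprod (\<lambda>k. Ta s k \<circ> Tb s k) ks F (a, b)
    = F (\<lambda>i. if i \<in> set ks then s * a i else a i, \<lambda>i. if i \<in> set ks then s * b i else b i)"
  using assms
proof (induction ks arbitrary: a b)
  case Nil
  then show ?case by (simp add: oprod_def)
next
  case (Cons k ks)
  have "(\<lambda>i. if i \<in> set ks then s * (c(k := s * c k)) i else (c(k := s * c k)) i)
    = (\<lambda>i. if i \<in> set (k # ks) then s * c i else c i)" for c :: "nat \<Rightarrow> complex"
    using Cons.prems by (auto simp: fun_eq_iff)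
  then show ?case
    using Cons by (simp add: oprod_Cons Ta_def Tb_def del: fun_upd_apply)
qed

lemma oprod_Tx:
  assumes "distinct ks"
  shows "oprod (Tx s) ks F x = F (\<lambda>i. if i \<in> set ks then s * x i else x i)"
  using assms
proof (induction ks arbitrary: x)
  case Nil
  then show ?case by (simp add: oprod_def)
next
  case (Cons k ks)
  have "(\<lambda>i. if i \<in> set ks then s * (x(k := s * x k)) i else (x(k := s * x k)) i)
    = (\<lambda>i. if i \<in> set (k # ks) then s * x i else x i)"
    using Cons.prems by (auto simp: fun_eq_iff)
  then show ?case
    using Cons by (simp add: oprod_Cons Tx_def del: fun_upd_apply)
qed

lemma RP_degene_product:
  assumes "RP_degene q lam M D z" "q powr (lam + 1) = A" "(a, b) \<in> D"
  shows "A * z (\<lambda>i. if i \<in> {1..M + 1} then q * a i else a i, \<lambda>i. if i \<in> {1..M + 1} then q * b i else b i)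
    = z (a, b)"
proof -
  have "annihilates_on D ((\<lambda>_. A) \<odot> oprod (\<lambda>k. Ta q k \<circ> Tb q k) [1..<M + 2] - id) z"
    using assms(1,2) unfolding RP_degene_def by blast
  moreover have "set [1..<M + 2] = {1..M + 1}" by auto
  ultimately show ?thesis
    using assms(3) oprod_shift[of "[1..<M + 2]" q z a b]
    unfolding annihilates_on_def scal_def fun_diff_def by fastforce
qed

lemma esym_0: "finite S \<Longrightarrow> esym 0 S g = 1"
proof -
  assume "finite S"
  then have "{X. X \<subseteq> S \<and> card X = 0} = {{}}" by (auto dest: finite_subset)
  then show ?thesis by (simp add: esym_def)
qed

lemma esym_1: "esym 1 {i} g = g i"
proof -
  have "{X. X \<subseteq> {i} \<and> card X = 1} = {{i}}" by (auto simp: subset_singleton_iff)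
  then show ?thesis by (simp add: esym_def)
qed

text \<open>The operator gives a relation between \<open>z\<close> at the point and its images under
  T, the inverse of T, and the identity. The product relation turns the inverse shift of index 1
  into the shift of index 2, up to the factor A, and writes \<open>w 1 1\<close> as A *
  \<open>w q q\<close>. What results is A times the four-term relation.\<close>

lemma four_term_one:
  assumes q: "q \<noteq> 0" and D: "shift_domain q 1 D" and z: "RP_degene q lam 1 D z"
    and A: "q powr (lam + 1) = A" "A \<noteq> 0" and ab: "(a, b) \<in> D"
  shows "four_term q z 1 2 (a, b) = 0"
proof -
  define w where "w = (\<lambda>i j. z (a(1 := i * a 1, 2 := j * a 2), b(1 := i * b 1, 2 := j * b 2)))"
  have b1: "b 1 \<noteq> 0" using shift_domainD(1)[OF D ab] .
  have ext: "(\<lambda>i. if i \<in> {1..1 + 1} then q * c i else c i) = c(1 := q * c 1, 2 := q * c 2)" for c :: "nat \<Rightarrow> complex"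
    by (auto simp: fun_eq_iff)
  have prod: "A * w q q = w 1 1"
    using RP_degene_product[OF z A(1) ab] unfolding ext by (simp add: w_def)
  \<comment> \<open>The product relation is also applied at this point, where index 1 is shifted
    back; there the full shift affects only index 2.\<close>
  have low: "(a(1 := 1 / q * a 1), b(1 := 1 / q * b 1)) \<in> D"
    using shift_domainD(5)[OF D shift_domainD(3)[OF D ab]] by auto
  have prod': "A * w 1 q = w (1 / q) 1"
  proof -
    have "(c(1 := 1 / q * c 1))(1 := q * (c(1 := 1 / q * c 1)) 1, 2 := q * (c(1 := 1 / q * c 1)) 2)
        = c(1 := 1 * c 1, 2 := q * c 2)"
      and "c(1 := 1 / q * c 1) = c(1 := 1 / q * c 1, 2 := 1 * c 2)" for c :: "nat \<Rightarrow> complex"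
      using q by (auto simp: fun_eq_iff)
    then show ?thesis
      using RP_degene_product[OF z A(1) low] unfolding ext w_def by metis
  qed
  have "E_op q lam 1 z (a, b) = 0"
    using z ab unfolding RP_degene_def annihilates_on_def by blast
  moreover have "{1..1 + 1 :: nat} = {1, 2}" by auto
  moreover have "esym 0 {2..1 + 1} c = 1" "esym 1 {2..1 + 1} c = c 2" for c
    using esym_0[of "{2}" c] esym_1[of 2 c] by (simp_all add: numeral_2_eq_2)
  moreover have w1: "w i 1 = z (a(1 := i * a 1), b(1 := i * b 1))" "w 1 1 = z (a, b)" for i
  proof -
    have "c(1 := t, 2 := 1 * c 2) = c(1 := t)" for c :: "nat \<Rightarrow> complex" and t
      by (auto simp: fun_eq_iff)
    then show "w i 1 = z (a(1 := i * a 1), b(1 := i * b 1))" by (simp only: w_def)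
    then show "w 1 1 = z (a, b)" by (simp add: w_def)
  qed
  ultimately have "- b 1 * (w (1 / q) 1 - a 1 / b 1 * w 1 1 - A * (w 1 1 - a 1 / b 1 * w q 1))
      + (a 2 * (w (1 / q) 1 - w 1 1) - A * b 2 * (w 1 1 - w q 1)) = 0"
    using q
    by (simp add: E_op_def Let_def scal_def oprod_def Ta_def Tb_def plus_fun_def fun_diff_def A)
  then have "A * ((b 1 - b 2) * w 1 1 + (b 2 - a 1) * w q 1 + (a 2 - b 1) * w 1 q + (a 1 - a 2) * w q q) = 0"
    using b1 prod prod' by (simp add: field_simps) algebra
  then show ?thesis
    unfolding w1 using A(2) by (simp add: four_term_def shiftT_def w_def fun_upd_twist)
qed

lemma four_term_zero:
  assumes q: "q \<noteq> 0" "norm q < 1" and D: "shift_domain q M D" and z: "RP_degene q lam M D z"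
    and A: "q powr (lam + 1) = A" "A \<noteq> 0"
    and ij: "i \<in> {1..M}" "j \<in> {1..M + 1}" "i \<noteq> j"
    and ab: "(a, b) \<in> D" and nz: "a (M + 1) \<noteq> 0"
  shows "four_term q z i j (a, b) = 0"
proof (cases "M = 1")
  case True
  then have "i = 1" "j = 2" using ij by auto
  then show ?thesis using four_term_one[of q D lam z A a b] assms True by simp
next
  case False
  then have "M \<ge> 2" using ij by auto
  then show ?thesis by (rule four_term_many[OF q D z _ ij ab nz])
qed

section \<open>The substitution and the Appell--Lauricella equations\<close>

lemma subst_point_upd:
  assumes "i \<in> {1..M}"
  shows "subst_point q M A B C (x(i := s * x i))
    = (case subst_point q M A B C x of (a, b) \<Rightarrow> (a(i := s * a i), b(i := s * b i)))"
  using assms by (auto simp: subst_point_def fun_eq_iff)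

theorem proposition4p4:
  fixes q lam A C :: complex and B :: "nat \<Rightarrow> complex" and M :: nat
    and D :: "point set" and z :: "point \<Rightarrow> complex"
  assumes "0 < norm q" and "norm q < 1"
    and "M \<ge> 1"
    and "shift_domain q M D"
    and "RP_degene q lam M D z"
    and "A \<noteq> 0"
    and "q powr lam = A / q"
  shows "appell_lauricella q M A B C
           {x \<in> {1..M} \<rightarrow>\<^sub>E UNIV. subst_point q M A B C x \<in> D}
           (\<lambda>x. z (subst_point q M A B C x))"
proof -
  let ?S = "subst_point q M A B C"
  let ?X = "{x \<in> {1..M} \<rightarrow>\<^sub>E UNIV. ?S x \<in> D}"
  let ?F = "\<lambda>x. z (?S x)"
  have q: "q \<noteq> 0" using assms(1) by auto
  have A: "q powr (lam + 1) = A" using assms(7) q by (simp add: powr_add)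
  note zero = four_term_zero[OF q assms(2,4,5) A assms(6)]
  have S_upd: "?S (x(i := q * x i)) = shiftT q i (?S x)" if "i \<in> {1..M}" for x i
    using subst_point_upd[OF that, of q A B C x q] by (simp add: shiftT_def)
  have sys1: "x i * (?F x - B i * ?F (x(i := q * x i)) - (?F (x(j := q * x j))
        - B i * ?F ((x(j := q * x j))(i := q * (x(j := q * x j)) i))))
      = x j * (?F x - B j * ?F (x(j := q * x j)) - (?F (x(i := q * x i))
        - B j * ?F ((x(i := q * x i))(j := q * (x(i := q * x i)) j))))"
    if ij: "i \<in> {1..M}" "j \<in> {1..M}" and x: "x \<in> ?X" for i j x
  proof (cases "i = j")
    case False
    have "four_term q z i j (?S x) = 0"
      using zero[of i j "fst (?S x)" "snd (?S x)"] ij x False q by (simp add: subst_point_def)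
    moreover have "fst (?S x) i = B i * x i" "fst (?S x) j = B j * x j" "snd (?S x) i = x i" "snd (?S x) j = x j"
      using ij by (auto simp: subst_point_def)
    ultimately have "(x i - x j) * ?F x + (x j - B i * x i) * z (shiftT q i (?S x))
        + (B j * x j - x i) * z (shiftT q j (?S x)) + (B i * x i - B j * x j) * z (shiftT q i (shiftT q j (?S x))) = 0"
      unfolding four_term_def by (simp add: case_prod_beta)
    then show ?thesis
      unfolding S_upd[OF ij(1)] S_upd[OF ij(2)] shiftT_commute[of q j i] by (simp add: algebra_simps)
  qed simp
  let ?all = "\<lambda>x i. if i \<in> {1..M} then q * x i else x i"
  have sys2: "?F x - C / q * ?F (?all x) - (?F (x(i := q * x i)) - C / q * ?F (?all (x(i := q * x i))))
      = x i * (?F x - A * ?F (?all x) - B i * (?F (x(i := q * x i)) - A * ?F (?all (x(i := q * x i)))))"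
    if i: "i \<in> {1..M}" and x: "x \<in> ?X" for i x
  proof -
    let ?k = "M + 1"
    \<comment> \<open>Undoing the shift of index M + 1 leads to a (M + 1) = 1 and b (M + 1) = C / (A
      * q); the four-term relation for i and M + 1 is taken there.\<close>
    define down where "down = (\<lambda>(a, b). (a(?k := 1 / q * a ?k), b(?k := 1 / q * b ?k)))"
    have down_in: "down v \<in> D" if "v \<in> D" for v
    proof -
      obtain a b where v: "v = (a, b)" by fastforce
      show ?thesis
        using shift_domainD(5)[OF assms(4) shift_domainD(3)[OF assms(4)]] that by (simp add: v down_def)
    qed
    have down_up: "shiftT q ?k (down v) = v" for v
      using q by (cases v) (simp add: down_def shiftT_def)
    \<comment> \<open>The full shift of \<open>down (?S y)\<close> restores the parameters of index
      M + 1 and multiplies every x by q, so the product relation expresses the common shift of all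
      x.\<close>
    have prod: "A * ?F (?all y) = z (down (?S y))" if "?S y \<in> D" for y
    proof -
      obtain a b where v: "down (?S y) = (a, b)" by fastforce
      then have ab: "a = (fst (?S y))(?k := 1 / q * fst (?S y) ?k)" "b = (snd (?S y))(?k := 1 / q * snd (?S y) ?k)"
        by (simp_all add: down_def case_prod_beta)
      have "(\<lambda>i. if i \<in> {1..M + 1} then q * a i else a i, \<lambda>i. if i \<in> {1..M + 1} then q * b i else b i) = ?S (?all y)"
        using q by (auto simp: ab subst_point_def fun_eq_iff)
      then show ?thesis
        using RP_degene_product[OF assms(5) A, of a b] down_in[OF that] v by simp
    qed
    have Ti: "?S (x(i := q * x i)) \<in> D"
      unfolding S_upd[OF i] using x i by (intro shiftT_in[OF assms(4)]) auto
    have comm: "down (shiftT q i (?S x)) = shiftT q i (down (?S x))"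
      using i by (auto simp: down_def shiftT_def subst_point_def fun_eq_iff)
    have vals: "fst (down (?S x)) i = B i * x i" "snd (down (?S x)) i = x i"
      "fst (down (?S x)) ?k = 1" "snd (down (?S x)) ?k = C / (A * q)"
      using i q by (auto simp: down_def subst_point_def)
    have "four_term q z i ?k (down (?S x)) = 0"
      using zero[of i ?k "fst (down (?S x))" "snd (down (?S x))"] down_in x i vals(3) by simp
    then have eq: "(x i - C / (A * q)) * z (down (?S x)) + (C / (A * q) - B i * x i) * z (shiftT q i (down (?S x)))
        + (1 - x i) * ?F x + (B i * x i - 1) * z (shiftT q i (?S x)) = 0"
      unfolding four_term_def using vals by (simp add: case_prod_beta down_up[simplified])
    have P: "A * ?F (?all x) = z (down (?S x))" "A * ?F (?all (x(i := q * x i))) = z (shiftT q i (down (?S x)))"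
      using prod[of x] prod[OF Ti] x unfolding S_upd[OF i] comm by auto
    have C: "C / q = C / (A * q) * A" using assms(6) by simp
    show ?thesis
      unfolding C mult.assoc P S_upd[OF i] using eq by (simp add: algebra_simps)
  qed
  have set_upt: "set [1..<M + 1] = {1..M}" by auto
  have 1: "annihilates_on ?X
          ((\<lambda>x. x i) \<odot> ((id - Tx q j) \<circ> (id - (\<lambda>_. B i) \<odot> Tx q i))
            - (\<lambda>x. x j) \<odot> ((id - Tx q i) \<circ> (id - (\<lambda>_. B j) \<odot> Tx q j))) ?F"
    if "i \<in> {1..M}" "j \<in> {1..M}" for i j
    unfolding annihilates_on_def
  proof
    fix x assume "x \<in> ?X"
    note sys1[OF that this]
    then show "((\<lambda>x. x i) \<odot> ((id - Tx q j) \<circ> (id - (\<lambda>_. B i) \<odot> Tx q i))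
            - (\<lambda>x. x j) \<odot> ((id - Tx q i) \<circ> (id - (\<lambda>_. B j) \<odot> Tx q j))) ?F x = 0"
      by (simp only: fun_diff_def scal_def comp_def Tx_def id_def right_minus_eq)
  qed
  have 2: "annihilates_on ?X
          (((id - Tx q i) \<circ> (id - (\<lambda>_. C / q) \<odot> oprod (Tx q) [1..<M + 1]))
            - (\<lambda>x. x i) \<odot> ((id - (\<lambda>_. B i) \<odot> Tx q i)
                \<circ> (id - (\<lambda>_. A) \<odot> oprod (Tx q) [1..<M + 1]))) ?F"
    if "i \<in> {1..M}" for i
    unfolding annihilates_on_def
  proof
    fix x assume "x \<in> ?X"
    note sys2[OF that this]
    then show "(((id - Tx q i) \<circ> (id - (\<lambda>_. C / q) \<odot> oprod (Tx q) [1..<M + 1]))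
            - (\<lambda>x. x i) \<odot> ((id - (\<lambda>_. B i) \<odot> Tx q i)
                \<circ> (id - (\<lambda>_. A) \<odot> oprod (Tx q) [1..<M + 1]))) ?F x = 0"
      by (simp only: fun_diff_def scal_def comp_def Tx_def id_def right_minus_eq
        oprod_Tx[OF distinct_upt] set_upt)
  qed
  show ?thesis unfolding appell_lauricella_def using 1 2 by blast
qed

end
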